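(* Let $d\in\mathbb{N}$ with $d\ge 3$. Let $\varrho\in[0,1)$, $\tilde\varrho>0$ and $\varrho^->0$ be any numbers with $\varrho^-\ge\varrho$ and $2\varrho^--\varrho=\tilde\varrho$. Then there exists a matrix $A\in\mathbb{R}^{N\times d}$ (for some $N\in\mathbb{N}$) such that the following two statements hold for any $\kappa_*\ge 1$. 1. There exists $y\in\mathbb{R}^N$ such that the problem $\min_{x:Ax=y}\|x\|_{\ell^1}$ has a unique minimizer $g^*$, with condition number $\kappa_*$, such that the corresponding null space property constants of $(A,g^* )$ are the given $\varrho,\tilde\varrho,\varrho^-$. Moreover, with $\mathcal{S}=\operatorname{supp}(g^* )$ and $\mathcal{S}^c=\{1,\dots,d\}\setminus\mathcal{S}$, the minimizers $x^\infty(\alpha)$, $\alpha>0$, satisfy $$\lim_{\alpha\downarrow0}\frac{\|x^\infty(\alpha)-g^*\|_{\ell^1}}{\alpha^{1-\varrho}}=|\mathcal{S}^c|\,(1+\tilde\varrho)\Big(\min_{i\in\mathcal{S}}|g^*_i|\Big)^{\varrho}\kappa_*^{\varrho^-}.$$ 2. There exists $y\in\mathbb{R}^N$ such that the problem $\min_{x:Ax=y}\|x\|_{\ell^1}$ has a unique minimizer $g^*$, with condition number $\kappa_*$, and such that, with $\mathcal{S}=\operatorname{supp}(g^* )$ and $\mathcal{S}^c=\{1,\dots,d\}\setminus\mathcal{S}$, the minimizers $x^\infty(\alpha)$, $\alpha>0$, satisfy $$\lim_{\alpha\downarrow0}\frac{\|(x^\infty(\alpha))_{\mathcal{S}^c}-g^*_{\mathcal{S}^c}\|_{\ell^\infty}}{\alpha^{1-\varrho}}=\frac{\|g^*\|_{\ell^\infty}^{\varrho}}{\kappa_*^{\varrho^-}}.$$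 Here, for given $A$, $y$ and $\alpha>0$, $x^\infty(\alpha)$ denotes the unique minimizer of $\min_{x:Ax=y}D_{H_\alpha}(x,0)$.
   Context: For $x\in\mathbb{R}^d$ and $T\subset\{1,\dots,d\}$, $x_T=(x_i)_{i\in T}$ and $\operatorname{supp}(x)=\{i:x_i\neq0\}$. For a differentiable strictly convex $F$, $D_F(p,q)=F(p)-F(q)-\langle\nabla F(q),p-q\rangle$. For $\alpha>0$, $H_\alpha(z)=\sum_{i=1}^d\big(z_i\operatorname{arsinh}(z_i/(2\alpha))-\sqrt{z_i^2+4\alpha^2}\big)$ on $\mathbb{R}^d$. If $g^*\ne0$ is the unique minimizer of $\min_{x:Ax=y}\|x\|_{\ell^1}$ and $\mathcal{S}=\operatorname{supp}(g^* )$, its condition number is $\max_{i\in\mathcal{S}}|g^*_i|/\min_{i\in\mathcal{S}}|g^*_i|$, and the null space property constants of $(A,g^* )$ (for $\ker A\neq\{0\}$) are $$\varrho=\sup_{0\ne n\in\ker A}\frac{-\sum_{i\in\mathcal{S}}\operatorname{sign}(g^*_i)n_i}{\|n_{\mathcal{S}^c}\|_{\ell^1}},\quad \varrho^-=\sup_{0\ne n\in\ker A}\frac{\sum_{i\in\mathcal{S}:\operatorname{sign}(g^*_i)n_i<0}|n_i|}{\|n_{\mathcal{S}^c}\|_{\ell^1}},\quad \tilde\varrho=\sup_{0\ne n\in\ker A}\frac{\|n_{\mathcal{S}}\|_{\ell^1}}{\|n_{\mathcal{S}^c}\|_{\ell^1}}.$$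
   Formalization: The two limit formulas are asserted only for ϱ>0; at ϱ=0 they are false: for κ_*=1 one gets x^∞(α)=g* for all α, so the limit is 0 rather than the positive value claimed. All other assertions are kept for ϱ=0. *)

theory Defs
  imports
    "HOL-Analysis.Derivative"
    "HOL-Library.Extended_Real"
    "Jordan_Normal_Form.Matrix_Kernel"
begin

text \<open>Vectors in \<open>\<real>^d\<close> are elements of \<^term>\<open>carrier_vec d\<close>, so the index set
  \<open>{1..d}\<close> becomes \<open>{..<d}\<close>.\<close>

definition supp :: "real vec \<Rightarrow> nat set" where
  "supp x = {i. i < dim_vec x \<and> x $ i \<noteq> 0}"

definition co_supp :: "real vec \<Rightarrow> nat set" where
  "co_supp x = {..<dim_vec x} - supp x"

text \<open>\<open>l1_on T x\<close> and \<open>linf_on T x\<close> are the norms of the restriction \<open>x\<^sub>T\<close>.\<close>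

definition l1_on :: "nat set \<Rightarrow> real vec \<Rightarrow> real" where
  "l1_on T x = (\<Sum>i\<in>T. \<bar>x $ i\<bar>)"

definition linf_on :: "nat set \<Rightarrow> real vec \<Rightarrow> real" where
  "linf_on T x = Max (insert 0 ((\<lambda>i. \<bar>x $ i\<bar>) ` T))"

definition l1_norm :: "real vec \<Rightarrow> real" where
  "l1_norm x = l1_on {..<dim_vec x} x"

definition linf_norm :: "real vec \<Rightarrow> real" where
  "linf_norm x = linf_on {..<dim_vec x} x"

text \<open>The gradient is given by the partial derivatives; this is the usual gradient where \<open>F\<close> is
  differentiable, the only case in which it is used.\<close>

definition grad :: "(real vec \<Rightarrow> real) \<Rightarrow> real vec \<Rightarrow> real vec" where
  "grad F q = vec (dim_vec q)
     (\<lambda>i. deriv (\<lambda>t. F (q + t \<cdot>\<^sub>v unit_vec (dim_vec q) i)) 0)"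

definition bregman :: "(real vec \<Rightarrow> real) \<Rightarrow> real vec \<Rightarrow> real vec \<Rightarrow> real" where
  "bregman F p q = F p - F q - grad F q \<bullet> (p - q)"

definition hyp_entropy :: "real \<Rightarrow> real vec \<Rightarrow> real" where
  "hyp_entropy \<alpha> z =
     (\<Sum>i<dim_vec z. z $ i * arsinh (z $ i / (2 * \<alpha>)) - sqrt ((z $ i)\<^sup>2 + 4 * \<alpha>\<^sup>2))"

definition feasible :: "real mat \<Rightarrow> real vec \<Rightarrow> real vec \<Rightarrow> bool" where
  "feasible A y x \<longleftrightarrow> x \<in> carrier_vec (dim_col A) \<and> A *\<^sub>v x = y"

definition unique_arg_min :: "('a \<Rightarrow> real) \<Rightarrow> ('a \<Rightarrow> bool) \<Rightarrow> 'a \<Rightarrow> bool" where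
  "unique_arg_min f P x \<longleftrightarrow> is_arg_min f P x \<and> (\<forall>z. is_arg_min f P z \<longrightarrow> z = x)"

definition max_supp :: "real vec \<Rightarrow> real" where
  "max_supp g = Max ((\<lambda>i. \<bar>g $ i\<bar>) ` supp g)"

definition min_supp :: "real vec \<Rightarrow> real" where
  "min_supp g = Min ((\<lambda>i. \<bar>g $ i\<bar>) ` supp g)"

definition condition_number :: "real vec \<Rightarrow> real" where
  "condition_number g = max_supp g / min_supp g"

text \<open>The null space property constants are suprema in the extended reals, so that an equation
  with a real number expresses in particular that the kernel is nontrivial and the supremum is
  finite.\<close>

definition nsp_rho :: "real mat \<Rightarrow> real vec \<Rightarrow> ereal" where
  "nsp_rho A g = (SUP n \<in> mat_kernel A - {0\<^sub>v (dim_col A)}.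
     ereal (- (\<Sum>i\<in>supp g. sgn (g $ i) * n $ i)) / ereal (l1_on (co_supp g) n))"

definition nsp_rho_minus :: "real mat \<Rightarrow> real vec \<Rightarrow> ereal" where
  "nsp_rho_minus A g = (SUP n \<in> mat_kernel A - {0\<^sub>v (dim_col A)}.
     ereal (\<Sum>i\<in>{i \<in> supp g. sgn (g $ i) * n $ i < 0}. \<bar>n $ i\<bar>) / ereal (l1_on (co_supp g) n))"

definition nsp_rho_tilde :: "real mat \<Rightarrow> real vec \<Rightarrow> ereal" where
  "nsp_rho_tilde A g = (SUP n \<in> mat_kernel A - {0\<^sub>v (dim_col A)}.
     ereal (l1_on (supp g) n) / ereal (l1_on (co_supp g) n))"

text \<open>Pitfall at \<open>\<rho> = 0\<close>, the reason why limits of \<open>\<parallel>x - g\<parallel> / \<alpha>\<^sup>1\<^sup>-\<^sup>\<rho>\<close> are only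
  identified for \<open>\<rho> > 0\<close>: if \<open>nsp_rho A g = 0\<close>, then the sum of \<open>sgn (g\<^sub>i) * n\<^sub>i\<close> over the support
  vanishes for every \<open>n\<close> in the kernel. If moreover \<open>condition_number g = 1\<close>, the gradient
  \<open>arsinh (g\<^sub>i / (2\<alpha>))\<close> of \<open>hyp_entropy \<alpha>\<close> at \<open>g\<close> is a multiple of \<open>sgn (g\<^sub>i)\<close>, hence orthogonal
  to the kernel, so \<open>g\<close> itself is the minimizer for every \<open>\<alpha>\<close> and the limit is \<open>0\<close>, whereas the
  asymptotic formula \<open>card (co_supp g) * (1 + \<rho>t) * min_supp g powr \<rho> * \<kappa> powr \<rho>m\<close> is positive.\<close>

end

theory Submission
  imports Defs
begin

unbundle no vec_syntax

text \<open>Choose \<open>A\<close> with one-dimensional kernel, spanned by \<open>v = (-m p, m q, 1, \<dots>, 1)\<close> with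
  \<open>p = \<rho>m\<close>, \<open>q = \<rho>m - \<rho>\<close> and \<open>m = d - 2\<close>, and let \<open>g = (a, b, 0, \<dots>, 0)\<close> with \<open>a, b > 0\<close>. The
  feasible set is the line \<open>g + t v\<close>, and the entropy minimizer is \<open>g + t(\<alpha>) v\<close> for the only zero
  \<open>t(\<alpha>)\<close> of the increasing function \<open>t \<mapsto> \<Sum>\<^sub>i v\<^sub>i arsinh ((g\<^sub>i + t v\<^sub>i) / (2 \<alpha>))\<close>. At
  \<open>t = c \<alpha> powr (1 - \<rho>)\<close> the logarithms of \<open>\<alpha>\<close> cancel and this function tends to \<open>m ln (c / L)\<close>
  with \<open>L = a powr p * b powr -q\<close>, so \<open>t(\<alpha>) / \<alpha> powr (1 - \<rho>)\<close> tends to \<open>L\<close>. The first claim is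
  the case \<open>(a, b) = (\<kappa>, 1)\<close>, the second one the case \<open>(a, b) = (1, \<kappa>)\<close>.\<close>

subsection \<open>Matrices with a one-dimensional kernel\<close>

text \<open>This is the identity minus the product of \<open>v\<close> with the transposed
  \<open>k\<close>-th unit vector, so it sends \<open>x\<close> to
  \<open>x - x $ k \<cdot>\<^sub>v v\<close>. When \<open>v $ k = 1\<close> it is the projection
  along \<open>v\<close> onto the vectors with vanishing \<open>k\<close>-th entry, a square matrix
  whose kernel is spanned by \<open>v\<close>.\<close>

definition line_mat :: "nat \<Rightarrow> real vec \<Rightarrow> real mat" where
  "line_mat k v = mat (dim_vec v) (dim_vec v)
     (\<lambda>(i, j). (if i = j then 1 else 0) - (if j = k then v $ i else 0))"

lemma line_mat_carrier [simp]: "v \<in> carrier_vec d \<Longrightarrow> line_mat k v \<in> carrier_mat d d"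
  by (auto simp: line_mat_def)

lemma dim_line_mat [simp]:
  "dim_row (line_mat k v) = dim_vec v" "dim_col (line_mat k v) = dim_vec v"
  by (auto simp: line_mat_def)

lemma line_mat_mult_vec:
  assumes "v \<in> carrier_vec d" "x \<in> carrier_vec d" "k < d"
  shows "line_mat k v *\<^sub>v x = x - x $ k \<cdot>\<^sub>v v"
proof (rule eq_vecI)
  fix i assume "i < dim_vec (x - x $ k \<cdot>\<^sub>v v)"
  then have i: "i < d" using assms by simp
  have "(line_mat k v *\<^sub>v x) $ i =
      (\<Sum>j = 0..<d. ((if i = j then 1 else 0) - (if j = k then v $ i else 0)) * x $ j)"
    using assms i by (simp add: line_mat_def scalar_prod_def)
  also have "\<dots> = (\<Sum>j = 0..<d. (if i = j then x $ j else 0) - (if j = k then v $ i * x $ j else 0))"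
    by (intro sum.cong) (auto simp: left_diff_distrib)
  also have "\<dots> = x $ i - v $ i * x $ k"
    using assms i by (simp add: sum_subtractf sum.delta sum.delta')
  finally show "(line_mat k v *\<^sub>v x) $ i = (x - x $ k \<cdot>\<^sub>v v) $ i"
    using assms i by simp
qed (use assms in simp)

text \<open>Equal images mean that \<open>x - g\<close> is \<open>v\<close> scaled by
  \<open>x $ k - g $ k\<close>. Conversely, adding \<open>t\<close> times \<open>v\<close> raises
  the \<open>k\<close>-th entry by exactly \<open>t\<close> because \<open>v $ k = 1\<close>, so the
  shift cancels.\<close>

lemma line_mat_eq_iff:
  assumes "v \<in> carrier_vec d" "x \<in> carrier_vec d" "g \<in> carrier_vec d" "k < d" "v $ k = 1"
  shows "line_mat k v *\<^sub>v x = line_mat k v *\<^sub>v g \<longleftrightarrow> (\<exists>t. x = g + t \<cdot>\<^sub>v v)"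
proof
  assume "line_mat k v *\<^sub>v x = line_mat k v *\<^sub>v g"
  then have eq: "x - x $ k \<cdot>\<^sub>v v = g - g $ k \<cdot>\<^sub>v v"
    using assms by (simp add: line_mat_mult_vec)
  have "x = g + (x $ k - g $ k) \<cdot>\<^sub>v v"
  proof (rule eq_vecI)
    fix i assume "i < dim_vec (g + (x $ k - g $ k) \<cdot>\<^sub>v v)"
    then have "i < d" using assms by simp
    then show "x $ i = (g + (x $ k - g $ k) \<cdot>\<^sub>v v) $ i"
      using assms arg_cong[OF eq, of "\<lambda>w. w $ i"] by (simp add: algebra_simps)
  qed (use assms in simp)
  then show "\<exists>t. x = g + t \<cdot>\<^sub>v v" by blast
next
  assume "\<exists>t. x = g + t \<cdot>\<^sub>v v"
  then obtain t where x: "x = g + t \<cdot>\<^sub>v v" by blast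
  show "line_mat k v *\<^sub>v x = line_mat k v *\<^sub>v g"
    unfolding line_mat_mult_vec[OF assms(1,2,4)] line_mat_mult_vec[OF assms(1,3,4)]
    using assms by (intro eq_vecI) (auto simp: x algebra_simps)
qed

lemma feasible_line_mat:
  assumes "v \<in> carrier_vec d" "g \<in> carrier_vec d" "k < d" "v $ k = 1"
  shows "feasible (line_mat k v) (line_mat k v *\<^sub>v g) x \<longleftrightarrow> (\<exists>t. x = g + t \<cdot>\<^sub>v v)"
  using line_mat_eq_iff[OF assms(1) _ assms(2-4)] assms(1,2) by (auto simp: feasible_def)

text \<open>The kernel is the fibre through zero, and \<open>v $ k = 1\<close> keeps
  \<open>v\<close> nonzero, so removing the zero vector removes exactly the scalar 0. Suprema over
  the kernel thereby become suprema over nonzero scalars.\<close>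

lemma kernel_line_mat:
  assumes "v \<in> carrier_vec d" "k < d" "v $ k = 1"
  shows "mat_kernel (line_mat k v) - {0\<^sub>v d} = (\<lambda>c. c \<cdot>\<^sub>v v) ` (- {0})"
proof -
  have *: "line_mat k v *\<^sub>v 0\<^sub>v d = 0\<^sub>v d"
    using assms by (auto simp: line_mat_mult_vec intro!: eq_vecI)
  have "x \<in> mat_kernel (line_mat k v) \<longleftrightarrow> (\<exists>t. x = t \<cdot>\<^sub>v v)" for x
    using line_mat_eq_iff[of v d x "0\<^sub>v d" k] assms
    by (auto simp: mat_kernel_def *)
  moreover have "t \<cdot>\<^sub>v v = 0\<^sub>v d \<longleftrightarrow> t = 0" for t
  proof
    assume "t \<cdot>\<^sub>v v = 0\<^sub>v d"
    then have "(t \<cdot>\<^sub>v v) $ k = (0\<^sub>v d :: real vec) $ k" by simp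
    then show "t = 0" using assms by simp
  qed (use assms in auto)
  ultimately show ?thesis by auto
qed

text \<open>Reduces both minimizations, of the l1 norm and of the Bregman divergence, to a
  comparison of values in one real parameter.\<close>

lemma unique_arg_min_line:
  assumes P: "\<And>x. P x \<longleftrightarrow> (\<exists>t. x = g + t \<cdot>\<^sub>v v)"
    and less: "\<And>s. s \<noteq> t \<Longrightarrow> f (g + t \<cdot>\<^sub>v v) < f (g + s \<cdot>\<^sub>v v)"
  shows "unique_arg_min f P (g + t \<cdot>\<^sub>v v)"
proof -
  have Pt: "P (g + t \<cdot>\<^sub>v v)" unfolding P by blast
  have "f (g + t \<cdot>\<^sub>v v) \<le> f y" if "P y" for y
  proof -
    from that obtain s where "y = g + s \<cdot>\<^sub>v v" unfolding P by blast
    then show ?thesis using less[of s] by (cases "s = t") simp_all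
  qed
  with Pt have "is_arg_min f P (g + t \<cdot>\<^sub>v v)"
    unfolding is_arg_min_linorder by blast
  moreover have "z = g + t \<cdot>\<^sub>v v" if z: "is_arg_min f P z" for z
  proof -
    have "P z" and le: "f z \<le> f (g + t \<cdot>\<^sub>v v)"
      using z Pt unfolding is_arg_min_linorder by blast+
    then obtain s where s: "z = g + s \<cdot>\<^sub>v v" unfolding P by blast
    show ?thesis
    proof (rule ccontr)
      assume "z \<noteq> g + t \<cdot>\<^sub>v v"
      then have "f (g + t \<cdot>\<^sub>v v) < f z" unfolding s by (intro less) auto
      then show False using le by simp
    qed
  qed
  ultimately show ?thesis unfolding unique_arg_min_def by blast
qed

subsection \<open>The entropy along a line\<close>

lemma sqrt_square_divide_add_1:
  assumes "(0::real) < \<alpha>"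
  shows "sqrt ((u / (2 * \<alpha>))\<^sup>2 + 1) = sqrt (u\<^sup>2 + 4 * \<alpha>\<^sup>2) / (2 * \<alpha>)"
  by (rule real_sqrt_unique) (use assms in \<open>simp_all add: power_divide field_simps\<close>)

text \<open>The product rule leaves the extra term
  \<open>z / sqrt (z\<^sup>2 + 4 * \<alpha>\<^sup>2)\<close>, which is exactly the derivative of the
  subtracted root.\<close>

lemma has_field_derivative_hyp_entropy_term:
  assumes "(0::real) < \<alpha>"
  shows "((\<lambda>z. z * arsinh (z / (2 * \<alpha>)) - sqrt (z\<^sup>2 + 4 * \<alpha>\<^sup>2))
    has_field_derivative arsinh (z / (2 * \<alpha>))) (at z)"
proof -
  have pos: "0 < z\<^sup>2 + 4 * \<alpha>\<^sup>2" using assms by (simp add: add_nonneg_pos)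
  have "((\<lambda>z. z / (2 * \<alpha>)) has_field_derivative 1 / (2 * \<alpha>)) (at z)"
    by (intro DERIV_cdivide DERIV_ident)
  from DERIV_chain2[OF arsinh_real_has_field_derivative this]
  have D: "((\<lambda>z. arsinh (z / (2 * \<alpha>))) has_field_derivative 1 / sqrt (z\<^sup>2 + 4 * \<alpha>\<^sup>2)) (at z)"
    using assms by (simp add: sqrt_square_divide_add_1)
  have "((\<lambda>z. sqrt (z\<^sup>2 + 4 * \<alpha>\<^sup>2)) has_field_derivative z / sqrt (z\<^sup>2 + 4 * \<alpha>\<^sup>2)) (at z)"
    using pos by (auto intro!: derivative_eq_intros simp: field_simps)
  from DERIV_diff[OF DERIV_mult[OF DERIV_ident D] this] show ?thesis by simp
qed

lemma has_field_derivative_hyp_entropy_line: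
  assumes "0 < \<alpha>" "g \<in> carrier_vec d" "v \<in> carrier_vec d"
  shows "((\<lambda>t. hyp_entropy \<alpha> (g + t \<cdot>\<^sub>v v)) has_field_derivative
    (\<Sum>i<d. v $ i * arsinh ((g $ i + t * v $ i) / (2 * \<alpha>)))) (at t)"
proof -
  have "((\<lambda>t. (\<Sum>i<d. (g $ i + t * v $ i) * arsinh ((g $ i + t * v $ i) / (2 * \<alpha>))
           - sqrt ((g $ i + t * v $ i)\<^sup>2 + 4 * \<alpha>\<^sup>2))) has_field_derivative
    (\<Sum>i<d. v $ i * arsinh ((g $ i + t * v $ i) / (2 * \<alpha>)))) (at t)"
  proof (rule DERIV_sum)
    fix i
    have "((\<lambda>t. g $ i + t * v $ i) has_field_derivative v $ i) (at t)"
      by (auto intro!: derivative_eq_intros)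
    from DERIV_chain2[OF has_field_derivative_hyp_entropy_term[OF assms(1)] this]
    show "((\<lambda>t. (g $ i + t * v $ i) * arsinh ((g $ i + t * v $ i) / (2 * \<alpha>))
           - sqrt ((g $ i + t * v $ i)\<^sup>2 + 4 * \<alpha>\<^sup>2)) has_field_derivative
        v $ i * arsinh ((g $ i + t * v $ i) / (2 * \<alpha>))) (at t)"
      by (simp add: mult.commute)
  qed
  moreover have "(\<lambda>t. hyp_entropy \<alpha> (g + t \<cdot>\<^sub>v v)) =
     (\<lambda>t. (\<Sum>i<d. (g $ i + t * v $ i) * arsinh ((g $ i + t * v $ i) / (2 * \<alpha>))
           - sqrt ((g $ i + t * v $ i)\<^sup>2 + 4 * \<alpha>\<^sup>2)))"
    using assms by (intro ext) (simp add: hyp_entropy_def)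
  ultimately show ?thesis by simp
qed

text \<open>The gradient of the entropy vanishes at zero because \<open>arsinh 0 = 0\<close>. The
  divergence from zero is therefore the entropy up to an additive constant and has the same
  minimizers.\<close>

lemma bregman_hyp_entropy_0:
  assumes "0 < \<alpha>" "z \<in> carrier_vec d"
  shows "bregman (hyp_entropy \<alpha>) z (0\<^sub>v d) = hyp_entropy \<alpha> z - hyp_entropy \<alpha> (0\<^sub>v d)"
proof -
  have "grad (hyp_entropy \<alpha>) (0\<^sub>v d) = 0\<^sub>v d"
  proof (rule eq_vecI)
    fix i assume "i < dim_vec (0\<^sub>v d :: real vec)"
    then have i: "i < d" by simp
    \<comment> \<open>A partial derivative is the derivative along the line through zero in a unit
      direction.\<close>
    have "deriv (\<lambda>t. hyp_entropy \<alpha> (0\<^sub>v d + t \<cdot>\<^sub>v unit_vec d i)) 0 =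
        (\<Sum>j<d. unit_vec d i $ j * arsinh ((0\<^sub>v d $ j + 0 * unit_vec d i $ j) / (2 * \<alpha>)))"
      by (rule DERIV_imp_deriv has_field_derivative_hyp_entropy_line)+ (use assms in auto)
    also have "\<dots> = 0" by (intro sum.neutral) auto
    finally show "grad (hyp_entropy \<alpha>) (0\<^sub>v d) $ i = (0\<^sub>v d :: real vec) $ i"
      using i by (simp add: grad_def)
  qed (simp add: grad_def)
  then show ?thesis using assms by (simp add: bregman_def)
qed

text \<open>The factor \<open>v $ i\<close> stands both outside and inside the increasing function
  \<open>arsinh\<close>, so each summand is nondecreasing whatever its sign, and strictly increasing
  where \<open>v $ i\<close> is nonzero. This expresses strict convexity of the entropy along the
  line.\<close>

lemma entropy_slope_strict_mono:
  fixes \<alpha> :: real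
  assumes "0 < \<alpha>" "k < d" "v $ k \<noteq> 0"
  shows "strict_mono (\<lambda>t. \<Sum>i<d. v $ i * arsinh ((g $ i + t * v $ i) / (2 * \<alpha>)))"
proof (rule strict_monoI)
  fix s t :: real assume st: "s < t"
  have strict: "v $ i * arsinh ((g $ i + s * v $ i) / (2 * \<alpha>))
      < v $ i * arsinh ((g $ i + t * v $ i) / (2 * \<alpha>))" if "v $ i \<noteq> 0" for i
  proof (cases "0 < v $ i")
    case True
    then show ?thesis using st assms by (simp add: divide_strict_right_mono)
  next
    case False
    with that have "v $ i < 0" by simp
    then show ?thesis using st assms
      by (simp add: mult_less_cancel_left_disj divide_strict_right_mono)
  qed
  show "(\<Sum>i<d. v $ i * arsinh ((g $ i + s * v $ i) / (2 * \<alpha>)))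
      < (\<Sum>i<d. v $ i * arsinh ((g $ i + t * v $ i) / (2 * \<alpha>)))"
  proof (rule sum_strict_mono_ex1)
    show "\<forall>i\<in>{..<d}. v $ i * arsinh ((g $ i + s * v $ i) / (2 * \<alpha>))
      \<le> v $ i * arsinh ((g $ i + t * v $ i) / (2 * \<alpha>))"
    proof
      fix i
      show "v $ i * arsinh ((g $ i + s * v $ i) / (2 * \<alpha>))
        \<le> v $ i * arsinh ((g $ i + t * v $ i) / (2 * \<alpha>))"
        using strict[of i] by (cases "v $ i = 0") auto
    qed
  qed (use assms strict in auto)
qed

text \<open>The \<open>k\<close>-th summand is \<open>arsinh (t / (2 * \<alpha>))\<close>, unbounded
  in both directions, while the remaining sum is monotone in \<open>t\<close>. The slope therefore
  changes sign, and the intermediate value theorem applies.\<close>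

lemma entropy_slope_zero_exists:
  fixes \<alpha> :: real
  assumes "0 < \<alpha>" "k < d" "v $ k = 1" "g $ k = 0"
  shows "\<exists>t. (\<Sum>i<d. v $ i * arsinh ((g $ i + t * v $ i) / (2 * \<alpha>))) = 0"
proof -
  define S where "S = (\<lambda>t. \<Sum>i<d. v $ i * arsinh ((g $ i + t * v $ i) / (2 * \<alpha>)))"
  define R where "R = (\<lambda>t. \<Sum>i\<in>{..<d}-{k}. v $ i * arsinh ((g $ i + t * v $ i) / (2 * \<alpha>)))"
  have split: "S t = arsinh (t / (2 * \<alpha>)) + R t" for t
    unfolding S_def R_def using assms by (subst sum.remove[of _ k]) auto
  have R_mono: "R s \<le> R t" if "s \<le> t" for s t
    unfolding R_def
  proof (rule sum_mono)
    fix i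
    show "v $ i * arsinh ((g $ i + s * v $ i) / (2 * \<alpha>))
        \<le> v $ i * arsinh ((g $ i + t * v $ i) / (2 * \<alpha>))"
    proof (cases "s = t \<or> v $ i = 0")
      case False
      \<comment> \<open>Monotonicity of a single summand is the one-dimensional case of the previous
        lemma.\<close>
      then show ?thesis
        using that assms entropy_slope_strict_mono[of \<alpha> 0 1 "vec 1 (\<lambda>_. v $ i)" "vec 1 (\<lambda>_. g $ i)"]
        by (auto simp: strict_mono_def intro!: less_imp_le)
    qed auto
  qed
  \<comment> \<open>At \<open>T\<close> and \<open>- T\<close> the \<open>k\<close>-th summand
    equals plus and minus \<open>\<bar>R 0\<bar>\<close>, enough to fix the sign of \<open>S\<close>
    there, since \<open>R (- T) \<le> R 0 \<le> R T\<close>.\<close>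
  define T where "T = 2 * \<alpha> * sinh \<bar>R 0\<bar>"
  have T: "0 \<le> T" "arsinh (T / (2 * \<alpha>)) = \<bar>R 0\<bar>" "arsinh (- T / (2 * \<alpha>)) = - \<bar>R 0\<bar>"
    using assms by (simp_all add: T_def arsinh_sinh_real flip: sinh_real_abs)
  have "S (- T) \<le> 0" "0 \<le> S T"
    using R_mono[of "- T" 0] R_mono[of 0 T] T split[of T] split[of "- T"] by auto
  moreover have "continuous_on {- T..T} S"
    unfolding S_def using assms by (auto intro!: continuous_intros)
  ultimately obtain t where "S t = 0"
    using IVT'[of S "- T" 0 T] T by auto
  then show ?thesis by (auto simp: S_def)
qed

text \<open>The slope is strictly increasing and vanishes at \<open>t\<close>, so the entropy
  strictly decreases before \<open>t\<close> and strictly increases after it.\<close>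

lemma hyp_entropy_line_less:
  assumes "0 < \<alpha>" "g \<in> carrier_vec d" "v \<in> carrier_vec d" "k < d" "v $ k \<noteq> 0"
    and zero: "(\<Sum>i<d. v $ i * arsinh ((g $ i + t * v $ i) / (2 * \<alpha>))) = 0"
    and "s \<noteq> t"
  shows "hyp_entropy \<alpha> (g + t \<cdot>\<^sub>v v) < hyp_entropy \<alpha> (g + s \<cdot>\<^sub>v v)"
proof -
  define S where "S = (\<lambda>t. \<Sum>i<d. v $ i * arsinh ((g $ i + t * v $ i) / (2 * \<alpha>)))"
  have S: "S u < S w" if "u < w" for u w
    using entropy_slope_strict_mono[OF assms(1,4,5), of g] that by (simp add: S_def strict_mono_def)
  have [simp]: "S t = 0" using zero by (simp add: S_def)
  have D: "((\<lambda>t. hyp_entropy \<alpha> (g + t \<cdot>\<^sub>v v)) has_field_derivative S u) (at u)" for u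
    unfolding S_def by (rule has_field_derivative_hyp_entropy_line[OF assms(1-3)])
  then have cont: "continuous_on X (\<lambda>t. hyp_entropy \<alpha> (g + t \<cdot>\<^sub>v v))" for X
    by (meson DERIV_isCont continuous_at_imp_continuous_on)
  show ?thesis
  proof (cases "t < s")
    case True
    show ?thesis
      by (rule DERIV_pos_imp_increasing_open[OF True _ cont])
        (use D S[of t] in auto)
  next
    case False
    with \<open>s \<noteq> t\<close> have "s < t" by simp
    show ?thesis
      by (rule DERIV_neg_imp_decreasing_open[OF \<open>s < t\<close> _ cont])
        (use D S[of _ t] in auto)
  qed
qed

lemma unique_arg_min_bregman_line:
  assumes "0 < \<alpha>" "g \<in> carrier_vec d" "v \<in> carrier_vec d" "k < d" "v $ k \<noteq> 0"
    and "\<And>x. P x \<longleftrightarrow> (\<exists>t. x = g + t \<cdot>\<^sub>v v)"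
    and "(\<Sum>i<d. v $ i * arsinh ((g $ i + t * v $ i) / (2 * \<alpha>))) = 0"
  shows "unique_arg_min (\<lambda>z. bregman (hyp_entropy \<alpha>) z (0\<^sub>v d)) P (g + t \<cdot>\<^sub>v v)"
proof (rule unique_arg_min_line[OF assms(6)])
  fix s assume "s \<noteq> t"
  from hyp_entropy_line_less[OF assms(1-5,7) this] assms(1-3)
  show "bregman (hyp_entropy \<alpha>) (g + t \<cdot>\<^sub>v v) (0\<^sub>v d) < bregman (hyp_entropy \<alpha>) (g + s \<cdot>\<^sub>v v) (0\<^sub>v d)"
    by (simp add: bregman_hyp_entropy_0)
qed


subsection \<open>The extremal kernel direction\<close>

text \<open>The factor \<open>d - 2\<close> is the l1 norm of the entries from index 2 on. Dividing
  by it turns the first two entries into \<open>- p\<close> and \<open>q\<close>, so the null space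
  property constants do not depend on \<open>d\<close>.\<close>

definition dir_vec :: "nat \<Rightarrow> real \<Rightarrow> real \<Rightarrow> real vec" where
  "dir_vec d p q = vec d (\<lambda>i. if i = 0 then - (real (d - 2) * p)
     else if i = 1 then real (d - 2) * q else 1)"

definition pos_vec :: "nat \<Rightarrow> real \<Rightarrow> real \<Rightarrow> real vec" where
  "pos_vec d a b = vec d (\<lambda>i. if i = 0 then a else if i = 1 then b else 0)"

lemma dir_vec_simps [simp]:
  "dir_vec d p q \<in> carrier_vec d" "dim_vec (dir_vec d p q) = d"
  "3 \<le> d \<Longrightarrow> dir_vec d p q $ 0 = - (real (d - 2) * p)"
  "3 \<le> d \<Longrightarrow> dir_vec d p q $ Suc 0 = real (d - 2) * q"
  "2 \<le> i \<Longrightarrow> i < d \<Longrightarrow> dir_vec d p q $ i = 1"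
  by (auto simp: dir_vec_def)

lemma pos_vec_simps [simp]:
  "pos_vec d a b \<in> carrier_vec d" "dim_vec (pos_vec d a b) = d"
  "3 \<le> d \<Longrightarrow> pos_vec d a b $ 0 = a"
  "3 \<le> d \<Longrightarrow> pos_vec d a b $ Suc 0 = b"
  "2 \<le> i \<Longrightarrow> i < d \<Longrightarrow> pos_vec d a b $ i = 0"
  by (auto simp: pos_vec_def)

section \<open>Support and extremal entries of the sparse vector\<close>

lemma lessThan_eq_insert_0_1: "3 \<le> d \<Longrightarrow> {..<d} = insert 0 (insert (Suc 0) {2..<d})"
  by auto

lemma sum_lessThan_0_1:
  fixes f :: "nat \<Rightarrow> 'a :: comm_monoid_add"
  shows "3 \<le> d \<Longrightarrow> (\<Sum>i<d. f i) = f 0 + (f (Suc 0) + (\<Sum>i = 2..<d. f i))"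
  by (simp add: lessThan_eq_insert_0_1)

lemma supp_pos_vec:
  "3 \<le> d \<Longrightarrow> 0 < a \<Longrightarrow> 0 < b \<Longrightarrow> supp (pos_vec d a b) = {0, Suc 0}"
  by (auto simp: supp_def pos_vec_def split: if_splits)

lemma co_supp_pos_vec:
  "3 \<le> d \<Longrightarrow> 0 < a \<Longrightarrow> 0 < b \<Longrightarrow> co_supp (pos_vec d a b) = {2..<d}"
  by (auto simp: co_supp_def supp_pos_vec)

lemma pos_vec_extrema:
  assumes "3 \<le> d" "0 < a" "0 < b"
  shows "max_supp (pos_vec d a b) = max a b" "min_supp (pos_vec d a b) = min a b"
    "linf_norm (pos_vec d a b) = max a b"
proof -
  show "max_supp (pos_vec d a b) = max a b" "min_supp (pos_vec d a b) = min a b"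
    using assms by (simp_all add: max_supp_def min_supp_def supp_pos_vec)
  show "linf_norm (pos_vec d a b) = max a b"
    unfolding linf_norm_def linf_on_def
  proof (rule Max_eqI)
    show "max a b \<in> insert 0 ((\<lambda>i. \<bar>pos_vec d a b $ i\<bar>) ` {..<dim_vec (pos_vec d a b)})"
      using assms by (auto simp: lessThan_eq_insert_0_1 max_def)
  qed (use assms in \<open>auto simp: lessThan_eq_insert_0_1\<close>)
qed

text \<open>With \<open>m = d - 2\<close>, a step \<open>s\<close> costs
  \<open>m * \<bar>s\<bar>\<close> off the support. On the support, dropping the absolute values
  shows that the sum is at least \<open>a + b - m * s * (p - q)\<close>, and
  \<open>\<bar>p - q\<bar> < 1\<close> makes the cost prevail.\<close>

lemma unique_arg_min_l1_norm_line:
  assumes "3 \<le> d" "0 < a" "0 < b" "\<bar>p - q\<bar> < 1"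
    and "\<And>x. P x \<longleftrightarrow> (\<exists>t. x = pos_vec d a b + t \<cdot>\<^sub>v dir_vec d p q)"
  shows "unique_arg_min l1_norm P (pos_vec d a b)"
proof -
  let ?g = "pos_vec d a b" and ?v = "dir_vec d p q" and ?m = "real (d - 2)"
  have norm: "l1_norm (?g + s \<cdot>\<^sub>v ?v) = \<bar>a - s * (?m * p)\<bar> + (\<bar>b + s * (?m * q)\<bar> + ?m * \<bar>s\<bar>)" for s
    using assms(1) by (simp add: l1_norm_def l1_on_def sum_lessThan_0_1)
  have "unique_arg_min l1_norm P (?g + 0 \<cdot>\<^sub>v ?v)"
  proof (rule unique_arg_min_line[OF assms(5)])
    fix s :: real assume "s \<noteq> 0"
    have "\<bar>s\<bar> * \<bar>p - q\<bar> < \<bar>s\<bar> * 1"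
      using \<open>s \<noteq> 0\<close> assms(4) by (intro mult_strict_left_mono) auto
    then have "s * (p - q) < \<bar>s\<bar>"
      using abs_ge_self[of "s * (p - q)"] unfolding abs_mult by linarith
    then have "?m * (s * (p - q)) < ?m * \<bar>s\<bar>"
      using assms(1) by (intro mult_strict_left_mono) auto
    moreover have "?m * (s * (p - q)) = s * (?m * p) - s * (?m * q)"
      by (simp only: right_diff_distrib mult.left_commute)
    moreover have "l1_norm (?g + 0 \<cdot>\<^sub>v ?v) = a + b"
      unfolding norm using assms(2,3) by simp
    ultimately show "l1_norm (?g + 0 \<cdot>\<^sub>v ?v) < l1_norm (?g + s \<cdot>\<^sub>v ?v)"
      unfolding norm[of s]
      using abs_ge_self[of "a - s * (?m * p)"] abs_ge_self[of "b + s * (?m * q)"] by linarith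
  qed
  moreover have "?g + 0 \<cdot>\<^sub>v ?v = ?g" by (intro eq_vecI) auto
  ultimately show ?thesis by simp
qed

text \<open>On the kernel vector \<open>c\<close> times \<open>v\<close> each quotient depends only
  on the sign of \<open>c\<close>. For positive \<open>c\<close> the values are
  \<open>p - q\<close>, \<open>p + q\<close> and \<open>p\<close>; for negative \<open>c\<close>
  they are \<open>q - p\<close>, \<open>p + q\<close> and \<open>q\<close>. Because
  \<open>q \<le> p\<close>, each supremum is attained at \<open>c = 1\<close>.\<close>

lemma nsp_constants:
  assumes "3 \<le> d" "0 < a" "0 < b" "0 \<le> q" "q \<le> p" "0 < p"
  defines "A \<equiv> line_mat 2 (dir_vec d p q)" and "g \<equiv> pos_vec d a b"
  shows "nsp_rho A g = ereal (p - q)" "nsp_rho_tilde A g = ereal (p + q)"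
    "nsp_rho_minus A g = ereal p"
proof -
  let ?m = "real (d - 2)" and ?v = "dir_vec d p q"
  have m: "0 < ?m" using assms(1) by simp
  have ker: "mat_kernel A - {0\<^sub>v (dim_col A)} = (\<lambda>c. c \<cdot>\<^sub>v ?v) ` (- {0})"
    using assms(1) by (simp add: A_def kernel_line_mat)
  have supp: "supp g = {0, Suc 0}" and cosupp: "co_supp g = {2..<d}"
    using assms by (auto simp: supp_pos_vec co_supp_pos_vec)
  have g: "g $ 0 = a" "g $ Suc 0 = b" using assms(1) by (simp_all add: g_def)
  have co: "l1_on (co_supp g) (c \<cdot>\<^sub>v ?v) = \<bar>c\<bar> * ?m" for c
    using assms(1) by (simp add: l1_on_def cosupp)
  \<comment> \<open>Common scheme for the three suprema: an upper bound for all scalars, with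
    equality at \<open>c = 1\<close>.\<close>
  have SUP: "(SUP n \<in> mat_kernel A - {0\<^sub>v (dim_col A)}. ereal (f n) / ereal (l1_on (co_supp g) n))
      = ereal r"
    if "\<And>c. c \<noteq> 0 \<Longrightarrow> f (c \<cdot>\<^sub>v ?v) \<le> \<bar>c\<bar> * (r * ?m)" "f ?v = r * ?m" for f r
    unfolding ker image_image
  proof (rule antisym[OF SUP_least SUP_upper2[of 1]])
    fix c :: real assume "c \<in> - {0}"
    then show "ereal (f (c \<cdot>\<^sub>v ?v)) / ereal (l1_on (co_supp g) (c \<cdot>\<^sub>v ?v)) \<le> ereal r"
      using that(1)[of c] m by (simp add: co divide_le_eq mult.commute mult.left_commute)
  qed (use that(2) m co[of 1] in auto)
  have abs1: "\<bar>c * (?m * r)\<bar> = \<bar>c\<bar> * (r * ?m)" if "0 \<le> r" for c r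
    using that m by (simp add: abs_mult)
  show "nsp_rho A g = ereal (p - q)"
    unfolding nsp_rho_def
  proof (rule SUP)
    fix c
    have "- (\<Sum>i\<in>supp g. sgn (g $ i) * (c \<cdot>\<^sub>v ?v) $ i) = c * (?m * (p - q))"
      using assms(1-3) by (simp add: supp g algebra_simps del: of_nat_diff)
    also have "\<dots> \<le> \<bar>c\<bar> * ((p - q) * ?m)"
      using abs_ge_self[of "c * (?m * (p - q))"] abs1[of "p - q" c] assms(5) by linarith
    finally show "- (\<Sum>i\<in>supp g. sgn (g $ i) * (c \<cdot>\<^sub>v ?v) $ i) \<le> \<bar>c\<bar> * ((p - q) * ?m)" .
  qed (use assms(1-3) in \<open>simp add: supp g algebra_simps del: of_nat_diff\<close>)
  show "nsp_rho_tilde A g = ereal (p + q)"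
    unfolding nsp_rho_tilde_def
    by (rule SUP) (use assms(1-6) in \<open>simp_all add: supp l1_on_def abs_mult algebra_simps del: of_nat_diff\<close>)
  \<comment> \<open>A positive \<open>c\<close> makes entry 0 negative and a negative
    \<open>c\<close> makes entry 1 nonpositive; the maxima with 0 encode this case
    distinction.\<close>
  have minus: "(\<Sum>i\<in>{i \<in> supp g. sgn (g $ i) * (c \<cdot>\<^sub>v ?v) $ i < 0}. \<bar>(c \<cdot>\<^sub>v ?v) $ i\<bar>)
      = max 0 (c * (?m * p)) + max 0 (- (c * (?m * q)))" for c
  proof -
    have "(\<Sum>i\<in>{i \<in> supp g. sgn (g $ i) * (c \<cdot>\<^sub>v ?v) $ i < 0}. \<bar>(c \<cdot>\<^sub>v ?v) $ i\<bar>)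
        = (\<Sum>i\<in>supp g. if sgn (g $ i) * (c \<cdot>\<^sub>v ?v) $ i < 0 then \<bar>(c \<cdot>\<^sub>v ?v) $ i\<bar> else 0)"
      by (intro sum.inter_filter) (simp add: supp)
    also have "\<dots> = max 0 (c * (?m * p)) + max 0 (- (c * (?m * q)))"
    proof -
      have "sgn a = 1" "sgn b = 1" using assms(2,3) by simp_all
      then show ?thesis using assms(1) by (simp add: supp g max_def abs_if del: of_nat_diff)
    qed
    finally show ?thesis .
  qed
  show "nsp_rho_minus A g = ereal p"
    unfolding nsp_rho_minus_def
  proof (rule SUP)
    fix c :: real assume "c \<noteq> 0"
    show "(\<Sum>i\<in>{i \<in> supp g. sgn (g $ i) * (c \<cdot>\<^sub>v ?v) $ i < 0}. \<bar>(c \<cdot>\<^sub>v ?v) $ i\<bar>)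
        \<le> \<bar>c\<bar> * (p * ?m)"
    proof (cases "0 < c")
      case True
      then have "0 \<le> c * (?m * p)" "0 \<le> c * (?m * q)" using assms(4-6) by simp_all
      then show ?thesis using True by (simp add: minus mult.commute del: of_nat_diff)
    next
      case False
      with \<open>c \<noteq> 0\<close> have c: "c < 0" by simp
      have "c * (?m * p) \<le> 0" using c m assms(6) by (simp add: mult_le_0_iff del: of_nat_diff)
      moreover have "- (c * (?m * q)) \<le> - (c * (?m * p))"
        using c m assms(5) by (simp add: mult_left_mono del: of_nat_diff)
      moreover have "\<bar>c\<bar> * (p * ?m) = - (c * (?m * p))" using c by simp
      ultimately show ?thesis unfolding minus by linarith
    qed
  next
    show "(\<Sum>i\<in>{i \<in> supp g. sgn (g $ i) * ?v $ i < 0}. \<bar>?v $ i\<bar>) = p * ?m"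
      using minus[of 1] assms(4-6) by (simp add: mult.commute del: of_nat_diff)
  qed
qed

subsection \<open>Asymptotics of the minimizers\<close>

text \<open>Splits off the singular part \<open>- ln \<alpha>\<close>; for fixed positive
  \<open>u\<close> the other logarithm tends to \<open>ln u\<close> as \<alpha> decreases to
  0.\<close>

lemma arsinh_divide_eq_ln:
  assumes "(0::real) < \<alpha>"
  shows "arsinh (u / (2 * \<alpha>)) = ln ((u + sqrt (u\<^sup>2 + 4 * \<alpha>\<^sup>2)) / 2) - ln \<alpha>"
proof -
  have eq: "u / (2 * \<alpha>) + sqrt ((u / (2 * \<alpha>))\<^sup>2 + 1)
      = (u + sqrt (u\<^sup>2 + 4 * \<alpha>\<^sup>2)) / 2 / \<alpha>"
    using assms by (simp add: sqrt_square_divide_add_1 add_divide_distrib)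
  have "0 < (u + sqrt (u\<^sup>2 + 4 * \<alpha>\<^sup>2)) / 2 / \<alpha>"
    using arsinh_real_aux[of "u / (2 * \<alpha>)"] by (simp only: eq)
  then have "0 < (u + sqrt (u\<^sup>2 + 4 * \<alpha>\<^sup>2)) / 2"
    using assms by (simp add: zero_less_divide_iff)
  from ln_divide_pos[OF this assms] show ?thesis by (simp only: arsinh_real_def eq)
qed

text \<open>The three terms contribute \<open>p * ln \<alpha>\<close>,
  \<open>- q * ln \<alpha>\<close> and \<open>- \<rho> * ln \<alpha>\<close>, which cancel by
  \<open>p - q = \<rho>\<close>. The perturbations of \<open>a\<close> and \<open>b\<close> vanish
  since \<open>\<rho> < 1\<close>, and \<open>0 < \<rho>\<close> makes the regular part of the last
  term tend to \<open>ln c\<close>.\<close>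

lemma entropy_slope_tendsto:
  fixes r s :: real
  assumes "0 < \<rho>" "\<rho> < 1" "0 < a" "0 < b" "p - q = \<rho>" "0 < c"
  shows "((\<lambda>\<alpha>. - (p * arsinh ((a - c * \<alpha> powr (1 - \<rho>) * r) / (2 * \<alpha>)))
      + q * arsinh ((b + c * \<alpha> powr (1 - \<rho>) * s) / (2 * \<alpha>))
      + arsinh (c * \<alpha> powr (1 - \<rho>) / (2 * \<alpha>))) \<longlongrightarrow> ln c - (p * ln a - q * ln b)) (at_right 0)"
proof -
  define G :: "real \<Rightarrow> real \<Rightarrow> real" where "G u \<alpha> = ln ((u + sqrt (u\<^sup>2 + 4 * \<alpha>\<^sup>2)) / 2)" for u \<alpha>
  have powr0: "((\<lambda>\<alpha>::real. \<alpha> powr e) \<longlongrightarrow> 0) (at_right 0)" if "0 < e" for e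
    using that by (intro tendsto_eq_intros) (auto simp: eventually_at_right_less intro!: eventually_at_rightI[of 0 1])
  have G_tendsto: "((\<lambda>\<alpha>. G (f \<alpha>) (h \<alpha>)) \<longlongrightarrow> ln l) (at_right 0)"
    if "0 < l" "(f \<longlongrightarrow> l) (at_right 0)" "(h \<longlongrightarrow> 0) (at_right 0)" for f h :: "real \<Rightarrow> real" and l
  proof -
    have "((\<lambda>\<alpha>. G (f \<alpha>) (h \<alpha>)) \<longlongrightarrow> ln ((l + sqrt (l\<^sup>2 + 4 * 0\<^sup>2)) / 2)) (at_right 0)"
      unfolding G_def using that by (intro tendsto_intros) auto
    then show ?thesis using that(1) by simp
  qed
  have lim: "((\<lambda>\<alpha>. - (p * G (a - c * \<alpha> powr (1 - \<rho>) * r) \<alpha>)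
      + q * G (b + c * \<alpha> powr (1 - \<rho>) * s) \<alpha>
      + G c (\<alpha> powr \<rho>)) \<longlongrightarrow> - (p * ln a) + q * ln b + ln c) (at_right 0)"
  proof (intro tendsto_add tendsto_minus tendsto_mult tendsto_const G_tendsto)
    show "((\<lambda>\<alpha>. a - c * \<alpha> powr (1 - \<rho>) * r) \<longlongrightarrow> a) (at_right 0)"
      using tendsto_diff[OF tendsto_const[of a] tendsto_mult_left_zero[OF tendsto_mult_right_zero[OF powr0[of "1 - \<rho>"]]]]
        assms by simp
    show "((\<lambda>\<alpha>. b + c * \<alpha> powr (1 - \<rho>) * s) \<longlongrightarrow> b) (at_right 0)"
      using tendsto_add[OF tendsto_const[of b] tendsto_mult_left_zero[OF tendsto_mult_right_zero[OF powr0[of "1 - \<rho>"]]]]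
        assms by simp
  qed (use assms powr0 in auto)
  have "\<forall>\<^sub>F \<alpha> in at_right 0. - (p * G (a - c * \<alpha> powr (1 - \<rho>) * r) \<alpha>)
      + q * G (b + c * \<alpha> powr (1 - \<rho>) * s) \<alpha> + G c (\<alpha> powr \<rho>)
    = - (p * arsinh ((a - c * \<alpha> powr (1 - \<rho>) * r) / (2 * \<alpha>)))
      + q * arsinh ((b + c * \<alpha> powr (1 - \<rho>) * s) / (2 * \<alpha>))
      + arsinh (c * \<alpha> powr (1 - \<rho>) / (2 * \<alpha>))"
    using eventually_at_right_less[of 0]
  proof eventually_elim
    fix \<alpha> :: real assume \<alpha>: "0 < \<alpha>"
    let ?u = "c * \<alpha> powr (1 - \<rho>)"
    \<comment> \<open>Writing \<alpha> as this product lets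
      \<open>\<alpha> powr (1 - \<rho>)\<close> be pulled out of the root. The vanishing argument
      \<open>?u\<close> is thus rescaled to the fixed \<open>c\<close>, with
      \<open>\<alpha> powr \<rho>\<close> as the new small parameter.\<close>
    have \<alpha>_eq: "\<alpha> = \<alpha> powr (1 - \<rho>) * \<alpha> powr \<rho>"
      using \<alpha> by (simp flip: powr_add)
    have "?u\<^sup>2 + 4 * \<alpha>\<^sup>2 = (\<alpha> powr (1 - \<rho>))\<^sup>2 * (c\<^sup>2 + 4 * (\<alpha> powr \<rho>)\<^sup>2)"
      by (subst (2) \<alpha>_eq) (simp add: algebra_simps power_mult_distrib)
    then have sq: "sqrt (?u\<^sup>2 + 4 * \<alpha>\<^sup>2) = \<alpha> powr (1 - \<rho>) * sqrt (c\<^sup>2 + 4 * (\<alpha> powr \<rho>)\<^sup>2)"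
      by (simp add: real_sqrt_mult)
    define K where "K = (c + sqrt (c\<^sup>2 + 4 * (\<alpha> powr \<rho>)\<^sup>2)) / 2"
    have "0 < K" using assms(6) by (simp add: K_def add_pos_nonneg)
    moreover have "(?u + sqrt (?u\<^sup>2 + 4 * \<alpha>\<^sup>2)) / 2 = \<alpha> powr (1 - \<rho>) * K"
      unfolding sq K_def by (simp add: algebra_simps)
    moreover have "G c (\<alpha> powr \<rho>) = ln K" by (simp add: G_def K_def)
    ultimately have "G ?u \<alpha> = (1 - \<rho>) * ln \<alpha> + G c (\<alpha> powr \<rho>)"
      using \<alpha> by (simp only: G_def) (simp add: ln_mult_pos ln_powr)
    then show "- (p * G (a - ?u * r) \<alpha>) + q * G (b + ?u * s) \<alpha> + G c (\<alpha> powr \<rho>)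
      = - (p * arsinh ((a - ?u * r) / (2 * \<alpha>))) + q * arsinh ((b + ?u * s) / (2 * \<alpha>))
        + arsinh (?u / (2 * \<alpha>))"
      unfolding arsinh_divide_eq_ln[OF \<alpha>] G_def[symmetric]
      by (simp add: left_diff_distrib right_diff_distrib flip: assms(5))
  qed
  from Lim_transform_eventually[OF lim this] show ?thesis by (simp add: algebra_simps)
qed

text \<open>At \<open>c * \<alpha> powr (1 - \<rho>)\<close> the slope tends to a positive multiple
  of \<open>ln c - ln L\<close>, so for small \<alpha> it is negative if \<open>c < L\<close> and
  positive if \<open>c > L\<close>. Monotonicity of the slope then places its zero
  \<open>t \<alpha>\<close> on the right side of each such point.\<close>

lemma minimizer_parameter_tendsto:
  assumes "3 \<le> d" "0 < \<rho>" "\<rho> < 1" "0 < a" "0 < b" "p - q = \<rho>"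
    and zero: "\<And>\<alpha>. 0 < \<alpha> \<Longrightarrow> (\<Sum>i<d. dir_vec d p q $ i *
      arsinh ((pos_vec d a b $ i + t \<alpha> * dir_vec d p q $ i) / (2 * \<alpha>))) = 0"
  shows "((\<lambda>\<alpha>. t \<alpha> / \<alpha> powr (1 - \<rho>)) \<longlongrightarrow> a powr p * b powr - q) (at_right 0)"
proof -
  let ?m = "real (d - 2)"
  define L where "L = a powr p * b powr - q"
  have L: "0 < L" "ln L = p * ln a - q * ln b"
    using assms by (simp_all add: L_def ln_mult_pos ln_powr)
  define S where "S \<alpha> u = (\<Sum>i<d. dir_vec d p q $ i *
      arsinh ((pos_vec d a b $ i + u * dir_vec d p q $ i) / (2 * \<alpha>)))" for \<alpha> u
  have S_eq: "S \<alpha> u = ?m * (- (p * arsinh ((a - u * (?m * p)) / (2 * \<alpha>)))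
      + q * arsinh ((b + u * (?m * q)) / (2 * \<alpha>)) + arsinh (u / (2 * \<alpha>)))" for \<alpha> u
    using assms(1) by (simp add: S_def sum_lessThan_0_1 algebra_simps)
  have S_less: "S \<alpha> u < S \<alpha> w \<longleftrightarrow> u < w" if "0 < \<alpha>" for \<alpha> u w
    unfolding S_def using that assms(1)
    by (intro strict_mono_less[OF entropy_slope_strict_mono[of \<alpha> 2]]) auto
  have S_zero: "S \<alpha> (t \<alpha>) = 0" if "0 < \<alpha>" for \<alpha> using zero[OF that] by (simp add: S_def)
  have lim: "((\<lambda>\<alpha>. S \<alpha> (c * \<alpha> powr (1 - \<rho>))) \<longlongrightarrow> ?m * (ln c - ln L)) (at_right 0)" if "0 < c" for c
    unfolding S_eq L(2) using assms that by (intro tendsto_mult tendsto_const entropy_slope_tendsto)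
  have m: "0 < ?m" using assms(1) by simp
  have lower: "\<forall>\<^sub>F \<alpha> in at_right 0. c < t \<alpha> / \<alpha> powr (1 - \<rho>)" if "0 < c" "c < L" for c
  proof -
    have "?m * (ln c - ln L) < 0" using that m by (simp add: mult_less_0_iff)
    from order_tendstoD(2)[OF lim[OF that(1)] this] eventually_at_right_less[of 0]
    show ?thesis
    proof eventually_elim
      case (elim \<alpha>)
      then have "c * \<alpha> powr (1 - \<rho>) < t \<alpha>"
        using S_less[of \<alpha> "c * \<alpha> powr (1 - \<rho>)" "t \<alpha>"] S_zero[of \<alpha>] by simp
      then show ?case using elim by (simp add: less_divide_eq)
    qed
  qed
  have upper: "\<forall>\<^sub>F \<alpha> in at_right 0. t \<alpha> / \<alpha> powr (1 - \<rho>) < c" if "L < c" for c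
  proof -
    have c: "0 < c" using that L(1) by simp
    have "0 < ?m * (ln c - ln L)" using that m L(1) by simp
    from order_tendstoD(1)[OF lim[OF c] this] eventually_at_right_less[of 0]
    show ?thesis
    proof eventually_elim
      case (elim \<alpha>)
      then have "t \<alpha> < c * \<alpha> powr (1 - \<rho>)"
        using S_less[of \<alpha> "t \<alpha>" "c * \<alpha> powr (1 - \<rho>)"] S_zero[of \<alpha>] by simp
      then show ?case using elim by (simp add: divide_less_eq)
    qed
  qed
  have "((\<lambda>\<alpha>. t \<alpha> / \<alpha> powr (1 - \<rho>)) \<longlongrightarrow> L) (at_right 0)"
  proof (rule order_tendstoI)
    fix c assume "c < L"
    \<comment> \<open>The comparison point must be positive for its logarithm to make sense, whereas
      \<open>c\<close> is arbitrary below \<open>L\<close>; hence the maximum with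
      \<open>L / 2\<close>.\<close>
    then have "\<forall>\<^sub>F \<alpha> in at_right 0. max c (L / 2) < t \<alpha> / \<alpha> powr (1 - \<rho>)"
      using L(1) by (intro lower) auto
    then show "\<forall>\<^sub>F \<alpha> in at_right 0. c < t \<alpha> / \<alpha> powr (1 - \<rho>)"
      by (rule eventually_mono) simp
  qed (rule upper)
  then show ?thesis by (simp add: L_def)
qed

section \<open>Error norms and their limits\<close>

lemma norms_along_dir_vec:
  fixes t :: real
  assumes "3 \<le> d" "0 < a" "0 < b" "0 \<le> p" "0 \<le> q"
  defines "e \<equiv> pos_vec d a b + t \<cdot>\<^sub>v dir_vec d p q - pos_vec d a b"
  shows "l1_norm e = real (d - 2) * (1 + p + q) * \<bar>t\<bar>"
    and "linf_on (co_supp (pos_vec d a b)) e = \<bar>t\<bar>"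
proof -
  show "l1_norm e = real (d - 2) * (1 + p + q) * \<bar>t\<bar>"
    using assms by (simp add: l1_norm_def l1_on_def sum_lessThan_0_1 abs_mult algebra_simps del: of_nat_diff)
  have "(\<lambda>i. \<bar>e $ i\<bar>) ` {2..<d} = (\<lambda>i. \<bar>t\<bar>) ` {2..<d}"
    by (intro image_cong) (simp_all add: e_def)
  \<comment> \<open>Since \<open>3 \<le> d\<close>, the range \<open>{2..<d}\<close> is nonempty, so
    the set of absolute values is the singleton of \<open>\<bar>t\<bar>\<close>.\<close>
  then show "linf_on (co_supp (pos_vec d a b)) e = \<bar>t\<bar>"
    using assms(1-3) by (simp add: linf_on_def co_supp_pos_vec image_constant_conv)
qed

text \<open>Both error norms are constant multiples of the absolute value of the line parameter, so
  one limit yields both. The minimizers are constructed for every \<rho> in the range, the limits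
  only for positive \<rho>.\<close>

lemma minimizers_asymptotics:
  assumes "3 \<le> d" "0 \<le> \<rho>" "\<rho> < 1" "0 < a" "0 < b" "p - q = \<rho>" "0 \<le> q"
    and P: "\<And>x. P x \<longleftrightarrow> (\<exists>t. x = pos_vec d a b + t \<cdot>\<^sub>v dir_vec d p q)"
  shows "\<exists>x. (\<forall>\<alpha>>0. unique_arg_min (\<lambda>z. bregman (hyp_entropy \<alpha>) z (0\<^sub>v d)) P (x \<alpha>)) \<and>
    (0 < \<rho> \<longrightarrow>
      ((\<lambda>\<alpha>. l1_norm (x \<alpha> - pos_vec d a b) / \<alpha> powr (1 - \<rho>)) \<longlongrightarrow>
        real (d - 2) * (1 + p + q) * (a powr p * b powr - q)) (at_right 0) \<and>
      ((\<lambda>\<alpha>. linf_on (co_supp (pos_vec d a b)) (x \<alpha> - pos_vec d a b) / \<alpha> powr (1 - \<rho>)) \<longlongrightarrow>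
        a powr p * b powr - q) (at_right 0))"
proof -
  let ?g = "pos_vec d a b" and ?v = "dir_vec d p q"
  have "\<exists>t. (\<Sum>i<d. ?v $ i * arsinh ((?g $ i + t * ?v $ i) / (2 * \<alpha>))) = 0" if "0 < \<alpha>" for \<alpha>
    using that assms(1) by (intro entropy_slope_zero_exists[of _ 2]) auto
  then obtain t where t: "\<And>\<alpha>. 0 < \<alpha> \<Longrightarrow>
      (\<Sum>i<d. ?v $ i * arsinh ((?g $ i + t \<alpha> * ?v $ i) / (2 * \<alpha>))) = 0"
    by metis
  have "unique_arg_min (\<lambda>z. bregman (hyp_entropy \<alpha>) z (0\<^sub>v d)) P (?g + t \<alpha> \<cdot>\<^sub>v ?v)" if "0 < \<alpha>" for \<alpha>
    using that assms(1) by (intro unique_arg_min_bregman_line[of \<alpha> ?g d ?v 2, OF _ _ _ _ _ P t]) auto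
  moreover have "((\<lambda>\<alpha>. l1_norm (?g + t \<alpha> \<cdot>\<^sub>v ?v - ?g) / \<alpha> powr (1 - \<rho>)) \<longlongrightarrow>
        real (d - 2) * (1 + p + q) * (a powr p * b powr - q)) (at_right 0)"
      "((\<lambda>\<alpha>. linf_on (co_supp ?g) (?g + t \<alpha> \<cdot>\<^sub>v ?v - ?g) / \<alpha> powr (1 - \<rho>)) \<longlongrightarrow>
        a powr p * b powr - q) (at_right 0)" if "0 < \<rho>"
  proof -
    \<comment> \<open>The limit is positive, so passing to absolute values leaves it
      unchanged.\<close>
    have "((\<lambda>\<alpha>. \<bar>t \<alpha> / \<alpha> powr (1 - \<rho>)\<bar>) \<longlongrightarrow> \<bar>a powr p * b powr - q\<bar>) (at_right 0)"
      using that assms t by (intro tendsto_rabs minimizer_parameter_tendsto)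
    then have lim: "((\<lambda>\<alpha>. \<bar>t \<alpha>\<bar> / \<alpha> powr (1 - \<rho>)) \<longlongrightarrow> a powr p * b powr - q) (at_right 0)"
      by (simp add: abs_mult)
    have pq: "0 \<le> p" using assms by simp
    note norms = norms_along_dir_vec[OF assms(1,4,5) pq assms(7)]
    show "((\<lambda>\<alpha>. linf_on (co_supp ?g) (?g + t \<alpha> \<cdot>\<^sub>v ?v - ?g) / \<alpha> powr (1 - \<rho>)) \<longlongrightarrow>
        a powr p * b powr - q) (at_right 0)"
      unfolding norms by (rule lim)
    show "((\<lambda>\<alpha>. l1_norm (?g + t \<alpha> \<cdot>\<^sub>v ?v - ?g) / \<alpha> powr (1 - \<rho>)) \<longlongrightarrow>
        real (d - 2) * (1 + p + q) * (a powr p * b powr - q)) (at_right 0)"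
      unfolding norms times_divide_eq_right[symmetric] by (intro tendsto_mult tendsto_const lim)
  qed
  ultimately show ?thesis by (intro exI[of _ "\<lambda>\<alpha>. ?g + t \<alpha> \<cdot>\<^sub>v ?v"]) auto
qed

section \<open>Choice of the parameters and of the two right-hand sides\<close>

theorem proposition2p7:
  fixes d :: nat and \<rho> \<rho>t \<rho>m :: real
  assumes "3 \<le> d"
    and "0 \<le> \<rho>" "\<rho> < 1" "0 < \<rho>t" "0 < \<rho>m"
    and "\<rho> \<le> \<rho>m" "2 * \<rho>m - \<rho> = \<rho>t"
  shows "\<exists>N. \<exists>A \<in> carrier_mat N d. \<forall>\<kappa>\<ge>1.
    (\<exists>y \<in> carrier_vec N. \<exists>g x.
        unique_arg_min l1_norm (feasible A y) g \<and> g \<noteq> 0\<^sub>v d \<and>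
        condition_number g = \<kappa> \<and>
        nsp_rho A g = ereal \<rho> \<and> nsp_rho_tilde A g = ereal \<rho>t \<and> nsp_rho_minus A g = ereal \<rho>m \<and>
        (\<forall>\<alpha>>0. unique_arg_min (\<lambda>z. bregman (hyp_entropy \<alpha>) z (0\<^sub>v d)) (feasible A y) (x \<alpha>)) \<and>
        (0 < \<rho> \<longrightarrow>
          ((\<lambda>\<alpha>. l1_norm (x \<alpha> - g) / \<alpha> powr (1 - \<rho>)) \<longlongrightarrow>
            real (card (co_supp g)) * (1 + \<rho>t) * min_supp g powr \<rho> * \<kappa> powr \<rho>m) (at_right 0))) \<and>
    (\<exists>y \<in> carrier_vec N. \<exists>g x.
        unique_arg_min l1_norm (feasible A y) g \<and> g \<noteq> 0\<^sub>v d \<and>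
        condition_number g = \<kappa> \<and>
        (\<forall>\<alpha>>0. unique_arg_min (\<lambda>z. bregman (hyp_entropy \<alpha>) z (0\<^sub>v d)) (feasible A y) (x \<alpha>)) \<and>
        (0 < \<rho> \<longrightarrow>
          ((\<lambda>\<alpha>. linf_on (co_supp g) (x \<alpha> - g) / \<alpha> powr (1 - \<rho>)) \<longlongrightarrow>
            linf_norm g powr \<rho> / \<kappa> powr \<rho>m) (at_right 0)))"
proof -
  \<comment> \<open>These values solve \<open>p - q = \<rho>\<close> and
    \<open>p + q = \<rho>t\<close>; \<open>\<rho> \<le> \<rho>m\<close> gives
    \<open>0 \<le> q\<close>.\<close>
  define p q where "p = \<rho>m" and "q = \<rho>m - \<rho>"
  have pq: "p - q = \<rho>" "p + q = \<rho>t" "0 \<le> q" "q \<le> p" "0 < p"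
    using assms by (auto simp: p_def q_def)
  define v where "v = dir_vec d p q"
  \<comment> \<open>The matrix is built from \<open>d\<close>, \<open>p\<close> and \<open>q\<close>
    alone, so it serves all \<kappa> and both claims; only \<open>y\<close> varies.\<close>
  define A where "A = line_mat 2 v"
  have v: "v \<in> carrier_vec d" "v $ 2 = 1" using assms(1) by (simp_all add: v_def)
  have A: "A \<in> carrier_mat d d" using v by (simp add: A_def)
  have feas: "feasible A (A *\<^sub>v pos_vec d a b) x \<longleftrightarrow> (\<exists>t. x = pos_vec d a b + t \<cdot>\<^sub>v dir_vec d p q)" for a b x
    using feasible_line_mat[OF v(1) _ _ v(2)] assms(1) by (simp add: A_def v_def)
  have yA: "A *\<^sub>v pos_vec d a b \<in> carrier_vec d" for a b using A by simp
  have l1: "unique_arg_min l1_norm (feasible A (A *\<^sub>v pos_vec d a b)) (pos_vec d a b)"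
    if "0 < a" "0 < b" for a b
    using that assms pq feas by (intro unique_arg_min_l1_norm_line[of d a b p q]) auto
  have nz: "pos_vec d a b \<noteq> 0\<^sub>v d" if "0 < a" for a b
    using that assms(1) pos_vec_simps(3)[of d a b] by fastforce
  note asym = minimizers_asymptotics[OF assms(1,2,3) _ _ pq(1,3) feas]
  show ?thesis
  proof (intro exI[of _ d] bexI[OF _ A] allI impI conjI)
    fix \<kappa> :: real assume \<kappa>: "1 \<le> \<kappa>"
    \<comment> \<open>With the large entry at index 0 the limit parameter is
      \<open>\<kappa> powr p\<close>, and the smallest entry 1 makes the factor
      \<open>min_supp ?g powr \<rho>\<close> equal to 1.\<close>
    let ?g = "pos_vec d \<kappa> 1"
    obtain x where x: "\<forall>\<alpha>>0. unique_arg_min (\<lambda>z. bregman (hyp_entropy \<alpha>) z (0\<^sub>v d))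
        (feasible A (A *\<^sub>v ?g)) (x \<alpha>)"
      "0 < \<rho> \<Longrightarrow> ((\<lambda>\<alpha>. l1_norm (x \<alpha> - ?g) / \<alpha> powr (1 - \<rho>)) \<longlongrightarrow>
        real (d - 2) * (1 + p + q) * (\<kappa> powr p * 1 powr - q)) (at_right 0)"
      using asym[of \<kappa> 1] \<kappa> by auto
    have "0 < \<rho> \<longrightarrow> ((\<lambda>\<alpha>. l1_norm (x \<alpha> - ?g) / \<alpha> powr (1 - \<rho>)) \<longlongrightarrow>
        real (card (co_supp ?g)) * (1 + \<rho>t) * min_supp ?g powr \<rho> * \<kappa> powr \<rho>m) (at_right 0)"
      using x(2) \<kappa> assms(1) pq(2) by (simp add: co_supp_pos_vec pos_vec_extrema p_def add.assoc)
    moreover have "condition_number ?g = \<kappa>"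
      using \<kappa> assms(1) by (simp add: condition_number_def pos_vec_extrema)
    moreover have "nsp_rho A ?g = ereal \<rho>" "nsp_rho_tilde A ?g = ereal \<rho>t"
        "nsp_rho_minus A ?g = ereal \<rho>m"
      using nsp_constants[OF assms(1) _ _ pq(3,4,5), of \<kappa> 1] \<kappa> pq(1,2)
      by (simp_all add: A_def v_def p_def)
    ultimately show "\<exists>y \<in> carrier_vec d. \<exists>g x.
        unique_arg_min l1_norm (feasible A y) g \<and> g \<noteq> 0\<^sub>v d \<and>
        condition_number g = \<kappa> \<and>
        nsp_rho A g = ereal \<rho> \<and> nsp_rho_tilde A g = ereal \<rho>t \<and> nsp_rho_minus A g = ereal \<rho>m \<and>
        (\<forall>\<alpha>>0. unique_arg_min (\<lambda>z. bregman (hyp_entropy \<alpha>) z (0\<^sub>v d)) (feasible A y) (x \<alpha>)) \<and>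
        (0 < \<rho> \<longrightarrow>
          ((\<lambda>\<alpha>. l1_norm (x \<alpha> - g) / \<alpha> powr (1 - \<rho>)) \<longlongrightarrow>
            real (card (co_supp g)) * (1 + \<rho>t) * min_supp g powr \<rho> * \<kappa> powr \<rho>m) (at_right 0))"
      using x(1) \<kappa> l1[of \<kappa> 1] nz[of \<kappa> 1]
      by (intro bexI[OF _ yA[of \<kappa> 1]] exI[of _ ?g] exI[of _ x] conjI) simp_all
  next
    fix \<kappa> :: real assume \<kappa>: "1 \<le> \<kappa>"
    \<comment> \<open>With the large entry at index 1 the limit parameter is
      \<open>\<kappa> powr - q\<close>, that is \<open>\<kappa> powr (\<rho> - \<rho>m)\<close>, and
      the sup norm of \<open>?g\<close> is \<kappa>.\<close>
    let ?g = "pos_vec d 1 \<kappa>"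
    obtain x where x: "\<forall>\<alpha>>0. unique_arg_min (\<lambda>z. bregman (hyp_entropy \<alpha>) z (0\<^sub>v d))
        (feasible A (A *\<^sub>v ?g)) (x \<alpha>)"
      "0 < \<rho> \<Longrightarrow> ((\<lambda>\<alpha>. linf_on (co_supp ?g) (x \<alpha> - ?g) / \<alpha> powr (1 - \<rho>)) \<longlongrightarrow>
        1 powr p * \<kappa> powr - q) (at_right 0)"
      using asym[of 1 \<kappa>] \<kappa> by auto
    have "- q = \<rho> - \<rho>m" by (simp add: q_def)
    then have "0 < \<rho> \<longrightarrow> ((\<lambda>\<alpha>. linf_on (co_supp ?g) (x \<alpha> - ?g) / \<alpha> powr (1 - \<rho>)) \<longlongrightarrow>
        linf_norm ?g powr \<rho> / \<kappa> powr \<rho>m) (at_right 0)"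
      using x(2) \<kappa> assms(1) by (simp add: pos_vec_extrema max_absorb2 powr_diff)
    moreover have "condition_number ?g = \<kappa>"
      using \<kappa> assms(1) by (simp add: condition_number_def pos_vec_extrema)
    ultimately show "\<exists>y \<in> carrier_vec d. \<exists>g x.
        unique_arg_min l1_norm (feasible A y) g \<and> g \<noteq> 0\<^sub>v d \<and>
        condition_number g = \<kappa> \<and>
        (\<forall>\<alpha>>0. unique_arg_min (\<lambda>z. bregman (hyp_entropy \<alpha>) z (0\<^sub>v d)) (feasible A y) (x \<alpha>)) \<and>
        (0 < \<rho> \<longrightarrow>
          ((\<lambda>\<alpha>. linf_on (co_supp g) (x \<alpha> - g) / \<alpha> powr (1 - \<rho>)) \<longlongrightarrow>
            linf_norm g powr \<rho> / \<kappa> powr \<rho>m) (at_right 0))"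
      using x(1) \<kappa> l1[of 1 \<kappa>] nz[of 1 \<kappa>]
      by (intro bexI[OF _ yA[of 1 \<kappa>]] exI[of _ ?g] exI[of _ x] conjI) simp_all
  qed
qed

end
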